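(* For $n\ge 3$, let $P^n=[A_1^n,\dots,A_n^n]$ be an $n$-gon and let $g_1^n,\dots,g_n^n$ be lines such that for each $i\in\{1,\dots,n\}$, $g_i^n$ passes through $A_i^n$. For $m\in\{4,\dots,n\}$, the $m$-gon $P^m=[A_1^m,\dots,A_m^m]$ with lines $g_1^m,\dots,g_m^m$ can be reduced in a step to the $(m-1)$-gon $P^{m-1}=[A_1^{m-1},\dots,A_{m-1}^{m-1}]$ with lines $g_1^{m-1},\dots,g_{m-1}^{m-1}$ by obeying the following procedure: - Choose two adjacent vertices $A_i^m$ and $A_{i+1}^m$, $i\in\{1,\dots,m\}$. - Replace $A_i^m$ and $A_{i+1}^m$ by $A_i^{m-1}=(A_{i-1}^m\times A_i^m)\times(A_{i+1}^m\times A_{i+2}^m)$. - Replace $g_i^m$ and $g_{i+1}^m$ by $g_i^{m-1}=A_i^{m-1}\times(g_i^m\times g_{i+1}^m)$. - For the other vertices, let $A_j^{m-1}=A_j^m$ for $j\in\{1,\dots,i-1\}$ and $A_j^{m-1}=A_{j+1}^m$ for $j\in\{i+1,\dots,m-1\}$. - Similarly, for the other lines, let $g_j^{m-1}=g_j^m$ for $j\in\{1,\dots,i-1\}$ and $g_j^{m-1}=g_{j+1}^m$ for $j\in\{i+1,\dots,m-1\}$. If it is possible to reduce $P^n$ in $n-3$ steps to a triangle $P^3$ for which $g_1^3,g_2^3,g_3^3$ are concurrent, then every sequence of $n-3$ steps will lead to such a triangle. Furthermore, this is the case if and only if $$\frac{A_1^nD_2^n}{D_2^nA_3^n}\cdot\frac{A_2^nD_3^n}{D_3^nA_4^n}\cdot\ldots\cdot\frac{A_n^nD_1^n}{D_1^nA_2^n}=1,$$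 where $D_i^n=g_i^n\times(A_{i-1}^n\times A_{i+1}^n)$ for $i\in\{1,\dots,n\}$.
   Context: $A\times B$ denotes the line through the points $A$ and $B$, and $g\times h$ the intersection point of the lines $g$ and $h$. For collinear points, $\frac{AB}{CD}$ is the quotient of the oriented lengths of the segments $AB$ and $CD$ on an oriented line. Indices are taken cyclically (modulo $m$ for an $m$-gon). If the chosen adjacent pair is $A_m^m,A_1^m$ (i.e. $i=m$), the new vertex and line take the place of the removed pair and the remaining vertices and lines keep their cyclic order.
   Formalization: The plane includes points at infinity, so three parallel lines count as concurrent; the product criterion is stated only when P^n can be reduced in n-3 steps to a non-degenerate triangle and every D_i^n is an ordinary point with nonzero denominators (it fails, e.g., for collinear 4-gons). *)

theory Defs
  imports "HOL-Analysis.Analysis"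
begin

text \<open>
  The plane is the extended Euclidean plane: intersection points of parallel lines are points at
  infinity. It is modelled as the real projective plane, whose points and lines are the one- and
  two-dimensional subspaces of \<open>\<real>\<^sup>3\<close>; incidence is inclusion.
\<close>

definition is_point :: "(real^3) set \<Rightarrow> bool" where
  "is_point P \<longleftrightarrow> subspace P \<and> dim P = 1"

definition is_line :: "(real^3) set \<Rightarrow> bool" where
  "is_line l \<longleftrightarrow> subspace l \<and> dim l = 2"

definition ordinary :: "real^2 \<Rightarrow> (real^3) set" where
  "ordinary p = span {vector [p$1, p$2, 1]}"

text \<open>\<open>join P Q\<close> is a line only for distinct points, \<open>meet g h\<close> a point only for distinct lines.\<close>

definition join :: "(real^3) set \<Rightarrow> (real^3) set \<Rightarrow> (real^3) set" where
  "join P Q = span (P \<union> Q)"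

definition meet :: "(real^3) set \<Rightarrow> (real^3) set \<Rightarrow> (real^3) set" where
  "meet g h = g \<inter> h"

text \<open>
  An \<open>m\<close>-gon is given by the values of a function on \<open>{1..m}\<close>; \<open>cyc m j\<close> is the index in \<open>{1..m}\<close>
  congruent to \<open>j\<close> modulo \<open>m\<close>.
\<close>

definition cyc :: "nat \<Rightarrow> nat \<Rightarrow> nat" where
  "cyc m j = (j + m - 1) mod m + 1"

definition polygon :: "nat \<Rightarrow> (nat \<Rightarrow> (real^3) set) \<Rightarrow> bool" where
  "polygon m A \<longleftrightarrow> (\<forall>i\<in>{1..m}. is_point (A i) \<and> A i \<noteq> A (cyc m (i + 1)))"

definition is_triangle :: "(nat \<Rightarrow> (real^3) set) \<Rightarrow> bool" where
  "is_triangle A \<longleftrightarrow> (\<forall>i\<in>{1..3}. is_point (A i)) \<and> \<not> (\<exists>l. is_line l \<and> (\<forall>i\<in>{1..3}. A i \<subseteq> l))"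

text \<open>The common point may lie at infinity, i.e. three parallel lines are concurrent.\<close>

definition concurrent :: "(nat \<Rightarrow> (real^3) set) \<Rightarrow> bool" where
  "concurrent g \<longleftrightarrow> (\<exists>P. is_point P \<and> (\<forall>i\<in>{1..3}. P \<subseteq> g i))"

text \<open>
  \<open>merge m i x X\<close> replaces the entries \<open>i\<close> and \<open>i + 1\<close> by \<open>x\<close>. For \<open>i = m\<close> the entries \<open>m\<close> and \<open>1\<close>
  are replaced; the new entry gets index \<open>1\<close>, which is congruent to \<open>m\<close> modulo \<open>m - 1\<close>.
\<close>

definition merge :: "nat \<Rightarrow> nat \<Rightarrow> 'a \<Rightarrow> (nat \<Rightarrow> 'a) \<Rightarrow> nat \<Rightarrow> 'a" where
  "merge m i x X j =
     (if i < m then (if j < i then X j else if j = i then x else X (j + 1))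
      else (if j = 1 then x else X j))"

definition new_vertex :: "nat \<Rightarrow> (nat \<Rightarrow> (real^3) set) \<Rightarrow> nat \<Rightarrow> (real^3) set" where
  "new_vertex m A i =
     meet (join (A (cyc m (i - 1))) (A i)) (join (A (cyc m (i + 1))) (A (cyc m (i + 2))))"

definition new_line ::
  "nat \<Rightarrow> (nat \<Rightarrow> (real^3) set) \<Rightarrow> (nat \<Rightarrow> (real^3) set) \<Rightarrow> nat \<Rightarrow> (real^3) set" where
  "new_line m A g i = join (new_vertex m A i) (meet (g i) (g (cyc m (i + 1))))"

text \<open>
  A step can be carried out if the two lines (or points) in every intersection (or join) are
  distinct and adjacent vertices of the resulting \<open>(m - 1)\<close>-gon are distinct again.
\<close>

definition step_defined ::
  "nat \<Rightarrow> (nat \<Rightarrow> (real^3) set) \<Rightarrow> (nat \<Rightarrow> (real^3) set) \<Rightarrow> nat \<Rightarrow> bool" where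
  "step_defined m A g i \<longleftrightarrow>
     join (A (cyc m (i - 1))) (A i) \<noteq> join (A (cyc m (i + 1))) (A (cyc m (i + 2))) \<and>
     g i \<noteq> g (cyc m (i + 1)) \<and>
     new_vertex m A i \<noteq> meet (g i) (g (cyc m (i + 1))) \<and>
     polygon (m - 1) (merge m i (new_vertex m A i) A)"

text \<open>
  \<open>reduces n A g m B h\<close>: the \<open>n\<close>-gon \<open>A\<close> with lines \<open>g\<close> can be reduced to the \<open>m\<close>-gon \<open>B\<close> with
  lines \<open>h\<close>, necessarily in \<open>n - m\<close> steps.
\<close>

inductive reduces ::
  "nat \<Rightarrow> (nat \<Rightarrow> (real^3) set) \<Rightarrow> (nat \<Rightarrow> (real^3) set) \<Rightarrow>
   nat \<Rightarrow> (nat \<Rightarrow> (real^3) set) \<Rightarrow> (nat \<Rightarrow> (real^3) set) \<Rightarrow> bool"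
  for n A g where
  start: "reduces n A g n A g"
| step: "\<lbrakk>reduces n A g m B h; 4 \<le> m; i \<in> {1..m}; step_defined m B h i\<rbrakk>
    \<Longrightarrow> reduces n A g (m - 1) (merge m i (new_vertex m B i) B) (merge m i (new_line m B h i) h)"

definition oriented_length :: "real^2 \<Rightarrow> real^2 \<Rightarrow> real^2 \<Rightarrow> real" where
  "oriented_length u P Q = (Q - P) \<bullet> u"

text \<open>
  The line carrying the segments is oriented from \<open>R\<close> to \<open>S\<close>; the opposite orientation gives the
  same quotient.
\<close>

definition oriented_ratio :: "real^2 \<Rightarrow> real^2 \<Rightarrow> real^2 \<Rightarrow> real^2 \<Rightarrow> real" where
  "oriented_ratio P Q R S =
     oriented_length (sgn (S - R)) P Q / oriented_length (sgn (S - R)) R S"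

text \<open>
  The foot \<open>D\<^sub>i\<close> exists as an ordinary point, and the quotient in which it occurs has a nonzero
  denominator.
\<close>

definition foot ::
  "nat \<Rightarrow> (nat \<Rightarrow> real^2) \<Rightarrow> (nat \<Rightarrow> (real^3) set) \<Rightarrow> nat \<Rightarrow> real^2 \<Rightarrow> bool" where
  "foot n A g i D \<longleftrightarrow>
     A (cyc n (i - 1)) \<noteq> A (cyc n (i + 1)) \<and>
     ordinary D = meet (g i) (join (ordinary (A (cyc n (i - 1)))) (ordinary (A (cyc n (i + 1))))) \<and>
     D \<noteq> A (cyc n (i + 1))"

end

theory Submission
  imports Defs
begin

text \<open>
  Choose homogeneous coordinates \<open>a\<^sub>i\<close> for the vertices and normal vectors \<open>\<nu>\<^sub>i\<close> for the lines. The
  quotient on the segment from \<open>A\<^sub>i\<^sub>-\<^sub>1\<close> to \<open>A\<^sub>i\<^sub>+\<^sub>1\<close> is \<open>- (\<nu>\<^sub>i \<bullet> a\<^sub>i\<^sub>-\<^sub>1) / (\<nu>\<^sub>i \<bullet> a\<^sub>i\<^sub>+\<^sub>1)\<close>, so without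
  denominators the condition on the product reads \<open>\<Prod> (\<nu>\<^sub>i \<bullet> a\<^sub>i\<^sub>-\<^sub>1) = (-1)\<^sup>m \<Prod> (\<nu>\<^sub>i \<bullet> a\<^sub>i\<^sub>+\<^sub>1)\<close>. If a
  step replaces \<open>a\<^sub>1, a\<^sub>2\<close> by \<open>v = \<kappa> a\<^sub>0 + \<mu> a\<^sub>1 = \<rho> a\<^sub>2 + \<sigma> a\<^sub>3\<close>, the new line has the normal vector
  \<open>(\<nu>\<^sub>2 \<bullet> v) \<nu>\<^sub>1 - (\<nu>\<^sub>1 \<bullet> v) \<nu>\<^sub>2\<close>, and the two products are multiplied by \<open>\<mu> \<rho>\<close> and \<open>- \<mu> \<rho>\<close>; these
  factors do not vanish because adjacent vertices stay distinct. Hence the condition is invariant. For a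
  triangle it says that the determinant of the matrix \<open>(\<nu>\<^sub>i \<bullet> a\<^sub>j)\<close> is zero, i.e. that the three
  lines are concurrent. The last vertices cannot be collinear if a step has been made, since otherwise
  the two sides intersected in that step would coincide.
\<close>

section \<open>Cyclic indices and products along a merged polygon\<close>

lemma cyc_in_range: "m \<ge> 1 \<Longrightarrow> cyc m j \<in> {1..m}"
  by (auto simp: cyc_def Suc_le_eq)

lemma cyc_id: "j \<in> {1..m} \<Longrightarrow> cyc m j = j"
  by (cases j) (auto simp: cyc_def)

lemma cyc_add_period:
  assumes "m \<ge> 1"
  shows "cyc m (j + m) = cyc m j"
proof -
  have "j + m + m - 1 = (j + m - 1) + m" using assms by simp
  then show ?thesis by (simp only: cyc_def mod_add_self2)
qed

lemma cyc_minus_period: "m < j \<Longrightarrow> cyc m (j - m) = cyc m j"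
  by (cases "m = 0") (use cyc_add_period[of m "j - m"] in auto)

lemma cyc_cyc_add:
  assumes "m \<ge> 1"
  shows "cyc m (cyc m j + k) = cyc m (j + k)"
proof -
  have "(j + m - 1) mod m + 1 + k + m - 1 = (j + m - 1) mod m + (k + m)" by simp
  moreover have "j + m - 1 + (k + m) = (j + k + m - 1) + m" using assms by simp
  ultimately show ?thesis
    by (simp only: cyc_def mod_add_left_eq mod_add_self2)
qed

lemma cyc_zero: "m \<ge> 1 \<Longrightarrow> cyc m 0 = m"
  by (simp add: cyc_def)

text \<open>Raising \<open>c\<close> by one moves the first factor to the end, by periodicity of
  \<open>cyc\<close>, so the value does not depend on \<open>c\<close>; \<open>c = 1\<close> gives
  the right-hand side. Cyclic products can thus start just before the pair that a step
  replaces.\<close>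

lemma prod_cyc_shift:
  fixes f :: "nat \<Rightarrow> 'a::comm_monoid_mult"
  assumes "m \<ge> 1"
  shows "(\<Prod>k<m. f (cyc m (c + k))) = (\<Prod>i=1..m. f i)"
proof -
  obtain M where M: "m = Suc M" using assms by (cases m) auto
  have rotate: "(\<Prod>k<m. f (cyc m (Suc c + k))) = (\<Prod>k<m. f (cyc m (c + k)))" for c
  proof -
    have "(\<Prod>k<m. f (cyc m (Suc c + k))) = (\<Prod>k<M. f (cyc m (c + Suc k))) * f (cyc m (c + m))"
      by (simp add: M)
    also have "\<dots> = (\<Prod>k<m. f (cyc m (c + k)))"
      unfolding cyc_add_period[OF assms] by (simp add: M prod.lessThan_Suc_shift mult.commute del: prod.lessThan_Suc)
    finally show ?thesis .
  qed
  have zero: "(\<Prod>k<m. f (cyc m (c + k))) = (\<Prod>k<m. f (cyc m (0 + k)))" for c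
    by (induction c) (simp_all add: rotate del: add_Suc)
  have "(\<Prod>k<m. f (cyc m (c + k))) = (\<Prod>k<m. f (cyc m (Suc 0 + k)))"
    using zero[of c] zero[of "Suc 0"] by simp
  also have "\<dots> = (\<Prod>k<m. f (Suc k))"
    by (intro prod.cong refl arg_cong[of _ _ f]) (use cyc_id in auto)
  also have "\<dots> = (\<Prod>i=1..m. f i)"
    by (simp add: prod.atLeast1_atMost_eq)
  finally show ?thesis .
qed

text \<open>Read cyclically from position \<open>i - 1\<close>, the merged sequence is the old entry
  before the pair, the new entry, then the old entries from \<open>i + 2\<close> on. This form hides
  the wrap-around for \<open>i = m\<close>. Truncated subtraction is harmless: for
  \<open>i = 1\<close>, \<open>cyc\<close> sends 0 to the last index.\<close>

lemma merge_cyc: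
  assumes "4 \<le> m" "i \<in> {1..m}"
  shows "merge m i x X (cyc (m - 1) (i - 1)) = X (cyc m (i - 1))"
    and "merge m i x X (cyc (m - 1) i) = x"
    and "\<And>k. 2 \<le> k \<Longrightarrow> k < m \<Longrightarrow>
           merge m i x X (cyc (m - 1) (i - 1 + k)) = X (cyc m (i + k))"
proof -
  show "merge m i x X (cyc (m - 1) (i - 1)) = X (cyc m (i - 1))"
  proof (cases "i = 1")
    case True
    then show ?thesis using assms by (auto simp: merge_def cyc_zero)
  next
    case False
    then have "cyc (m - 1) (i - 1) = i - 1" "cyc m (i - 1) = i - 1"
      using assms by (auto intro!: cyc_id)
    then show ?thesis using assms False by (auto simp: merge_def)
  qed
  show "merge m i x X (cyc (m - 1) i) = x"
  proof (cases "i = m")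
    case True
    then have "cyc (m - 1) i = cyc (m - 1) 1"
      using assms cyc_add_period[of "m - 1" 1] by simp
    then show ?thesis using assms True by (auto simp: merge_def cyc_id)
  next
    case False
    then show ?thesis using assms by (auto simp: merge_def cyc_id)
  qed
  fix k :: nat assume k: "2 \<le> k" "k < m"
  show "merge m i x X (cyc (m - 1) (i - 1 + k)) = X (cyc m (i + k))"
  proof (cases "i + k \<le> m")
    case True
    have "cyc (m - 1) (i - 1 + k) = i - 1 + k" "cyc m (i + k) = i + k"
      using assms k True by (auto intro!: cyc_id)
    then show ?thesis using assms k True by (auto simp: merge_def)
  next
    case False
    \<comment> \<open>Past the end, the new index and the period are both one smaller than the old
      ones, so both indices reduce to \<open>i + k - m\<close>.\<close>
    have r: "i + k - m \<in> {1..m}" "i + k - m \<in> {1..m - 1}" using assms k False by auto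
    have "cyc m (i + k) = cyc m (i + k - m)"
      using cyc_minus_period[of m "i + k"] False by simp
    moreover have "i - 1 + k - (m - 1) = i + k - m" using assms False by auto
    then have "cyc (m - 1) (i - 1 + k) = cyc (m - 1) (i + k - m)"
      using cyc_minus_period[of "m - 1" "i - 1 + k"] False assms by simp
    ultimately have "cyc (m - 1) (i - 1 + k) = i + k - m" "cyc m (i + k) = i + k - m"
      using cyc_id[OF r(1)] cyc_id[OF r(2)] by simp_all
    then show ?thesis using assms k False by (auto simp: merge_def)
  qed
qed

text \<open>Only factors of adjacent pairs that meet the replaced entries change: three before, two
  after. \<open>F\<close> is arbitrary because the two products in \<open>balanced\<close> combine
  normals and vertices in opposite directions.\<close>

lemma cyclic_prod_merge:
  fixes F :: "'a \<Rightarrow> 'a \<Rightarrow> 'b::comm_monoid_mult"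
  assumes m: "4 \<le> m" and i: "i \<in> {1..m}"
  obtains T where
    "(\<Prod>j=1..m. F (X j) (X (cyc m (j + 1)))) =
       F (X (cyc m (i - 1))) (X i) * F (X i) (X (cyc m (i + 1))) *
       F (X (cyc m (i + 1))) (X (cyc m (i + 2))) * T"
    and "\<And>x. (\<Prod>j=1..m - 1. F (merge m i x X j) (merge m i x X (cyc (m - 1) (j + 1)))) =
       F (X (cyc m (i - 1))) x * F x (X (cyc m (i + 2))) * T"
proof -
  obtain M where M: "m = M + 4" using m by (metis add.commute le_Suc_ex)
  \<comment> \<open>The \<open>M + 1 = m - 3\<close> untouched adjacent pairs, from position
    \<open>i + 2\<close> around to \<open>i - 1\<close>; no inserted entry occurs in them.\<close>
  define T where "T = (\<Prod>k<M + 1. F (X (cyc m (i - 1 + (k + 3)))) (X (cyc m (i - 1 + (k + 4)))))"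
  have c: "i - 1 + 1 = i" "i - 1 + 2 = i + 1" "i - 1 + 3 = i + 2" using i by auto
  have split: "(\<Prod>k<N + 3. f k) = f 0 * f 1 * f 2 * (\<Prod>k<N. f (k + 3))" for f :: "nat \<Rightarrow> 'b" and N
    by (simp add: prod.lessThan_Suc_shift eval_nat_numeral mult.assoc del: prod.lessThan_Suc)
  have split2: "(\<Prod>k<N + 2. f k) = f 0 * f 1 * (\<Prod>k<N. f (k + 2))" for f :: "nat \<Rightarrow> 'b" and N
    by (simp add: prod.lessThan_Suc_shift eval_nat_numeral mult.assoc del: prod.lessThan_Suc)
  have "(\<Prod>j=1..m. F (X j) (X (cyc m (j + 1)))) =
      (\<Prod>k<m. F (X (cyc m (i - 1 + k))) (X (cyc m (cyc m (i - 1 + k) + 1))))"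
    using prod_cyc_shift[of m "\<lambda>j. F (X j) (X (cyc m (j + 1)))" "i - 1"] m by simp
  also have "\<dots> = (\<Prod>k<(M + 1) + 3. F (X (cyc m (i - 1 + k))) (X (cyc m (i - 1 + (k + 1)))))"
    using m by (simp only: cyc_cyc_add M) (simp add: algebra_simps)
  also have "\<dots> = F (X (cyc m (i - 1 + 0))) (X (cyc m (i - 1 + 1))) *
       F (X (cyc m (i - 1 + 1))) (X (cyc m (i - 1 + 2))) *
       F (X (cyc m (i - 1 + 2))) (X (cyc m (i - 1 + 3))) * T"
    unfolding split T_def by (simp add: numeral_eq_Suc)
  finally have old: "(\<Prod>j=1..m. F (X j) (X (cyc m (j + 1)))) =
       F (X (cyc m (i - 1))) (X i) * F (X i) (X (cyc m (i + 1))) *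
       F (X (cyc m (i + 1))) (X (cyc m (i + 2))) * T"
    unfolding c using i by (simp add: cyc_id)
  have new: "(\<Prod>j=1..m - 1. F (merge m i x X j) (merge m i x X (cyc (m - 1) (j + 1)))) =
       F (X (cyc m (i - 1))) x * F x (X (cyc m (i + 2))) * T" for x
  proof -
    let ?Y = "merge m i x X"
    have "(\<Prod>j=1..m - 1. F (?Y j) (?Y (cyc (m - 1) (j + 1)))) =
        (\<Prod>k<m - 1. F (?Y (cyc (m - 1) (i - 1 + k))) (?Y (cyc (m - 1) (cyc (m - 1) (i - 1 + k) + 1))))"
      using prod_cyc_shift[of "m - 1" "\<lambda>j. F (?Y j) (?Y (cyc (m - 1) (j + 1)))" "i - 1"] m by simp
    also have "\<dots> = (\<Prod>k<(M + 1) + 2. F (?Y (cyc (m - 1) (i - 1 + k))) (?Y (cyc (m - 1) (i - 1 + (k + 1)))))"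
      using m by (subst cyc_cyc_add) (simp_all add: M numeral_eq_Suc)
    also have "\<dots> = F (?Y (cyc (m - 1) (i - 1 + 0))) (?Y (cyc (m - 1) (i - 1 + 1))) *
         F (?Y (cyc (m - 1) (i - 1 + 1))) (?Y (cyc (m - 1) (i - 1 + 2))) *
         (\<Prod>k<M + 1. F (?Y (cyc (m - 1) (i - 1 + (k + 2)))) (?Y (cyc (m - 1) (i - 1 + (k + 3)))))"
      unfolding split2 by (simp add: numeral_eq_Suc)
    also have "(\<Prod>k<M + 1. F (?Y (cyc (m - 1) (i - 1 + (k + 2)))) (?Y (cyc (m - 1) (i - 1 + (k + 3))))) = T"
      unfolding T_def
    proof (intro prod.cong refl)
      fix k assume "k \<in> {..<M + 1}"
      then have "2 \<le> k + 2" "k + 2 < m" "2 \<le> k + 3" "k + 3 < m" by (auto simp: M)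
      moreover have "i + (k + 2) = i - 1 + (k + 3)" "i + (k + 3) = i - 1 + (k + 4)" using i by auto
      ultimately show "F (?Y (cyc (m - 1) (i - 1 + (k + 2)))) (?Y (cyc (m - 1) (i - 1 + (k + 3)))) =
          F (X (cyc m (i - 1 + (k + 3)))) (X (cyc m (i - 1 + (k + 4))))"
        using merge_cyc(3)[OF m i] by metis
    qed
    also have "?Y (cyc (m - 1) (i - 1 + 0)) = X (cyc m (i - 1))"
      using merge_cyc(1)[OF m i] by simp
    also have "?Y (cyc (m - 1) (i - 1 + 1)) = x"
      using merge_cyc(2)[OF m i] c by simp
    also have "?Y (cyc (m - 1) (i - 1 + 2)) = X (cyc m (i + 2))"
      using merge_cyc(3)[OF m i, of 2] m by simp
    finally show ?thesis .
  qed
  show thesis using that[OF old new] .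
qed

section \<open>Points and lines of the projective plane as subspaces\<close>

lemma join_span: "join (span {a}) (span {b}) = span {a, b}"
  unfolding join_def
proof
  show "span (span {a} \<union> span {b}) \<subseteq> span {a, b}"
    by (intro span_minimal Un_least span_mono subspace_span) auto
  show "span {a, b} \<subseteq> span (span {a} \<union> span {b})"
    by (intro span_mono) (auto simp: span_base)
qed

lemma in_span_pair:
  fixes a b :: "real^3"
  assumes "x \<in> span {a, b}"
  obtains s t where "x = s *\<^sub>R a + t *\<^sub>R b"
proof -
  obtain s where "x - s *\<^sub>R a \<in> span {b}"
    using assms span_breakdown_eq[of x a "{b}"] by auto
  then obtain t where "x - s *\<^sub>R a = t *\<^sub>R b"
    by (auto simp: span_singleton)
  then have "x = s *\<^sub>R a + t *\<^sub>R b" by (simp add: algebra_simps)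
  then show thesis by (rule that)
qed

lemma span_singleton_eq:
  fixes a b :: "real^3"
  assumes "a \<noteq> 0" "a \<in> span {b}"
  shows "span {a} = span {b}"
proof -
  obtain k where k: "a = k *\<^sub>R b" using assms by (auto simp: span_singleton)
  then have "b = inverse k *\<^sub>R a" using assms(1) by simp
  then have "b \<in> span {a}" by (metis span_base span_scale singletonI)
  then show ?thesis using assms(2) by (simp add: span_eq)
qed

lemma is_point_span:
  assumes "a \<noteq> 0"
  shows "is_point (span {a})"
  using assms by (simp add: is_point_def subspace_span dim_singleton)

lemma is_pointE:
  assumes "is_point P"
  obtains a where "a \<noteq> 0" "P = span {a}"
proof -
  have P: "subspace P" "dim P = 1" using assms by (auto simp: is_point_def)
  then obtain a where a: "a \<in> P" "a \<noteq> 0"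
    by (metis dim_eq_0 subsetI singletonI zero_neq_one)
  have "span {a} = P"
    using a P by (intro subspace_dim_equal) (auto simp: subspace_span span_minimal)
  then show thesis using that a by auto
qed

lemma is_line_span:
  assumes "a \<noteq> 0" "b \<noteq> 0" "span {a} \<noteq> span {b}"
  shows "is_line (span {a, b})"
proof -
  have "a \<notin> span {b}" using span_singleton_eq[of a b] assms by auto
  then have "independent {a, b}" "a \<noteq> b"
    using assms by (auto simp: independent_insert span_base)
  then have "dim {a, b} = 2" by (simp add: dim_eq_card_independent)
  then show ?thesis by (simp add: is_line_def subspace_span)
qed

lemma is_line_eq:
  assumes "is_line g" "is_line h" "g \<subseteq> h"
  shows "g = h"
  using assms by (simp add: is_line_def subspace_dim_equal)

lemma is_line_hyperplane:
  fixes n :: "real^3"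
  assumes "n \<noteq> 0"
  shows "is_line {x. n \<bullet> x = 0}"
  using assms by (simp add: is_line_def dim_hyperplane subspace_hyperplane)

lemma is_lineE:
  assumes "is_line l"
  obtains n where "n \<noteq> 0" "l = {x. n \<bullet> x = 0}"
proof -
  have l: "subspace l" "dim l = 2" using assms by (auto simp: is_line_def)
  then obtain n where n: "n \<noteq> 0" "span l = {x. n \<bullet> x = 0}"
    using dim_eq_hyperplane[of l] by auto
  then show thesis using that[of n] l by (metis span_eq_iff)
qed

text \<open>Two distinct planes through the origin have a sum of dimension 3, so the dimension
  formula leaves 2 + 2 - 3 = 1 for the intersection.\<close>

lemma is_point_meet:
  assumes "is_line g" "is_line h" "g \<noteq> h"
  shows "is_point (meet g h)"
proof -
  have s: "subspace g" "subspace h" "dim g = 2" "dim h = 2"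
    using assms by (auto simp: is_line_def)
  define U where "U = {x + y |x y. x \<in> g \<and> y \<in> h}"
  have U: "subspace U" unfolding U_def using s by (intro subspace_sums)
  have "x + 0 \<in> U" if "x \<in> g" for x
    unfolding U_def using that subspace_0[OF s(2)] by blast
  then have g: "g \<subseteq> U" by auto
  have "0 + x \<in> U" if "x \<in> h" for x
    unfolding U_def using that subspace_0[OF s(1)] by blast
  then have h: "h \<subseteq> U" by auto
  have "dim U \<noteq> 2"
  proof
    assume "dim U = 2"
    then have "is_line U" using U by (simp add: is_line_def)
    then have "g = U" "h = U" using is_line_eq g h assms(1,2) by blast+
    then show False using assms(3) by simp
  qed
  moreover have "dim U \<ge> 2" using dim_subset[OF g] s by simp
  moreover have "dim U \<le> 3" using dim_subset_UNIV[of U] by simp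
  moreover have "dim U + dim (g \<inter> h) = 4"
    unfolding U_def using dim_sums_Int[OF s(1,2)] s(3,4) by simp
  ultimately have "dim (g \<inter> h) = 1" by linarith
  then show ?thesis using s by (simp add: is_point_def meet_def subspace_inter)
qed

section \<open>Homogeneous coordinates and the effect of one step\<close>

text \<open>Representatives are determined only up to nonzero factors. This is harmless, since each
  \<open>a j\<close> and each \<open>\<nu> j\<close> occurs exactly once on either side of
  \<open>balanced\<close>.\<close>

definition homogeneous_coords ::
  "nat \<Rightarrow> (nat \<Rightarrow> (real^3) set) \<Rightarrow> (nat \<Rightarrow> (real^3) set) \<Rightarrow> (nat \<Rightarrow> real^3) \<Rightarrow> (nat \<Rightarrow> real^3) \<Rightarrow> bool"
  where "homogeneous_coords m A g a \<nu> \<longleftrightarrow>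
    (\<forall>j\<in>{1..m}. a j \<noteq> 0 \<and> A j = span {a j} \<and> \<nu> j \<noteq> 0 \<and> g j = {x. \<nu> j \<bullet> x = 0} \<and> \<nu> j \<bullet> a j = 0)"

text \<open>The first product is \<open>\<Prod> (\<nu>\<^sub>j \<bullet> a\<^sub>j\<^sub>-\<^sub>1)\<close>, shifted by one to avoid subtraction of indices.\<close>

definition balanced :: "nat \<Rightarrow> (nat \<Rightarrow> real^3) \<Rightarrow> (nat \<Rightarrow> real^3) \<Rightarrow> bool" where
  "balanced m a \<nu> \<longleftrightarrow>
    (\<Prod>j=1..m. \<nu> (cyc m (j + 1)) \<bullet> a j) = (-1) ^ m * (\<Prod>j=1..m. \<nu> j \<bullet> a (cyc m (j + 1)))"

text \<open>Every combination of the two normals vanishes on the intersection of the lines; the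
  coefficients of \<open>n\<close> make it vanish at \<open>v\<close> too. If \<open>n\<close> were
  0, then \<open>v\<close> would lie on both lines or the normals would be proportional, against
  \<open>off\<close> and \<open>ne\<close>.\<close>

lemma merged_line_eq:
  fixes v :: "real^3"
  assumes n: "n = (\<nu>\<^sub>2 \<bullet> v) *\<^sub>R \<nu>\<^sub>1 - (\<nu>\<^sub>1 \<bullet> v) *\<^sub>R \<nu>\<^sub>2"
    and nz: "\<nu>\<^sub>1 \<noteq> 0" "\<nu>\<^sub>2 \<noteq> 0" "v \<noteq> 0"
    and ne: "{x. \<nu>\<^sub>1 \<bullet> x = 0} \<noteq> {x. \<nu>\<^sub>2 \<bullet> x = 0}"
    and off: "span {v} \<noteq> meet {x. \<nu>\<^sub>1 \<bullet> x = 0} {x. \<nu>\<^sub>2 \<bullet> x = 0}"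
  shows "n \<noteq> 0"
    and "join (span {v}) (meet {x. \<nu>\<^sub>1 \<bullet> x = 0} {x. \<nu>\<^sub>2 \<bullet> x = 0}) = {x. n \<bullet> x = 0}"
proof -
  let ?M = "meet {x. \<nu>\<^sub>1 \<bullet> x = 0} {x. \<nu>\<^sub>2 \<bullet> x = 0}"
  obtain c where c: "c \<noteq> 0" "?M = span {c}"
    by (rule is_pointE[OF is_point_meet[OF is_line_hyperplane[OF nz(1)] is_line_hyperplane[OF nz(2)] ne]])
  have "v \<notin> ?M" using span_singleton_eq[of v c] c off nz by auto
  then have v: "\<nu>\<^sub>1 \<bullet> v \<noteq> 0 \<or> \<nu>\<^sub>2 \<bullet> v \<noteq> 0" by (auto simp: meet_def)
  show "n \<noteq> 0"
  proof
    assume "n = 0"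
    then have eq: "(\<nu>\<^sub>2 \<bullet> v) *\<^sub>R \<nu>\<^sub>1 = (\<nu>\<^sub>1 \<bullet> v) *\<^sub>R \<nu>\<^sub>2" using n by simp
    then have "\<nu>\<^sub>1 \<bullet> v \<noteq> 0" "\<nu>\<^sub>2 \<bullet> v \<noteq> 0" using v nz by auto
    moreover have "(\<nu>\<^sub>2 \<bullet> v) * (\<nu>\<^sub>1 \<bullet> x) = (\<nu>\<^sub>1 \<bullet> v) * (\<nu>\<^sub>2 \<bullet> x)" for x
      by (metis eq inner_scaleR_left)
    ultimately have "\<nu>\<^sub>1 \<bullet> x = 0 \<longleftrightarrow> \<nu>\<^sub>2 \<bullet> x = 0" for x by (metis mult_eq_0_iff)
    then show False using ne by auto
  qed
  show "join (span {v}) ?M = {x. n \<bullet> x = 0}"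
  proof
    have "span {v} \<union> ?M \<subseteq> {x. n \<bullet> x = 0}"
      by (auto simp: n meet_def span_singleton inner_diff_left)
    then show "join (span {v}) ?M \<subseteq> {x. n \<bullet> x = 0}"
      unfolding join_def by (intro span_minimal subspace_hyperplane)
    show "{x. n \<bullet> x = 0} \<subseteq> join (span {v}) ?M"
    proof
      fix x assume "x \<in> {x. n \<bullet> x = 0}"
      then have eq: "(\<nu>\<^sub>2 \<bullet> v) * (\<nu>\<^sub>1 \<bullet> x) = (\<nu>\<^sub>1 \<bullet> v) * (\<nu>\<^sub>2 \<bullet> x)"
        by (simp add: n inner_diff_left)
      \<comment> \<open>The values of the two normals at \<open>x\<close> are proportional to their
        values at \<open>v\<close>, which are not both 0. Subtracting \<open>t *\<^sub>R v\<close>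
        therefore moves \<open>x\<close> into the intersection of the lines.\<close>
      obtain t where "\<nu>\<^sub>1 \<bullet> x = t * (\<nu>\<^sub>1 \<bullet> v)" "\<nu>\<^sub>2 \<bullet> x = t * (\<nu>\<^sub>2 \<bullet> v)"
      proof (cases "\<nu>\<^sub>1 \<bullet> v = 0")
        case True
        then show thesis using v eq that[of "(\<nu>\<^sub>2 \<bullet> x) / (\<nu>\<^sub>2 \<bullet> v)"] by auto
      next
        case False
        then show thesis using eq that[of "(\<nu>\<^sub>1 \<bullet> x) / (\<nu>\<^sub>1 \<bullet> v)"] by (simp add: field_simps)
      qed
      then have "x - t *\<^sub>R v \<in> ?M" by (simp add: meet_def inner_diff_right)
      moreover have "t *\<^sub>R v \<in> span {v}" by (simp add: span_base span_scale)
      ultimately have "(x - t *\<^sub>R v) + t *\<^sub>R v \<in> join (span {v}) ?M"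
        unfolding join_def by (intro span_add span_base) auto
      then show "x \<in> join (span {v}) ?M" by simp
    qed
  qed
qed

text \<open>Subscripts 0 to 3 are consecutive positions, 1 and 2 being replaced. Expanding
  \<open>v\<close> by its first form at \<open>a\<^sub>0\<close> and by its second at
  \<open>a\<^sub>3\<close> makes the terms with \<open>\<kappa>\<close> and \<open>\<sigma>\<close>
  cancel.\<close>

lemma merged_inner_products:
  fixes v :: "real^3"
  assumes v: "v = \<kappa> *\<^sub>R a\<^sub>0 + \<mu> *\<^sub>R a\<^sub>1" "v = \<rho> *\<^sub>R a\<^sub>2 + \<sigma> *\<^sub>R a\<^sub>3"
    and inc: "\<nu>\<^sub>0 \<bullet> a\<^sub>0 = 0" "\<nu>\<^sub>1 \<bullet> a\<^sub>1 = 0" "\<nu>\<^sub>2 \<bullet> a\<^sub>2 = 0" "\<nu>\<^sub>3 \<bullet> a\<^sub>3 = 0"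
    and n: "n = (\<nu>\<^sub>2 \<bullet> v) *\<^sub>R \<nu>\<^sub>1 - (\<nu>\<^sub>1 \<bullet> v) *\<^sub>R \<nu>\<^sub>2"
  shows "(n \<bullet> a\<^sub>0) * (\<nu>\<^sub>3 \<bullet> v) = \<mu> * \<rho> * ((\<nu>\<^sub>1 \<bullet> a\<^sub>0) * (\<nu>\<^sub>2 \<bullet> a\<^sub>1) * (\<nu>\<^sub>3 \<bullet> a\<^sub>2))"
    and "(\<nu>\<^sub>0 \<bullet> v) * (n \<bullet> a\<^sub>3) = - (\<mu> * \<rho> * ((\<nu>\<^sub>0 \<bullet> a\<^sub>1) * (\<nu>\<^sub>1 \<bullet> a\<^sub>2) * (\<nu>\<^sub>2 \<bullet> a\<^sub>3)))"
proof -
  have left: "\<nu> \<bullet> v = \<kappa> * (\<nu> \<bullet> a\<^sub>0) + \<mu> * (\<nu> \<bullet> a\<^sub>1)" for \<nu>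
    unfolding v(1) by (simp add: inner_add_right)
  have right: "\<nu> \<bullet> v = \<rho> * (\<nu> \<bullet> a\<^sub>2) + \<sigma> * (\<nu> \<bullet> a\<^sub>3)" for \<nu>
    unfolding v(2) by (simp add: inner_add_right)
  have "n \<bullet> a\<^sub>0 = \<mu> * ((\<nu>\<^sub>1 \<bullet> a\<^sub>0) * (\<nu>\<^sub>2 \<bullet> a\<^sub>1))"
    unfolding n by (simp add: inner_diff_left left inc algebra_simps)
  moreover have "\<nu>\<^sub>3 \<bullet> v = \<rho> * (\<nu>\<^sub>3 \<bullet> a\<^sub>2)" by (simp add: right inc)
  ultimately show "(n \<bullet> a\<^sub>0) * (\<nu>\<^sub>3 \<bullet> v) = \<mu> * \<rho> * ((\<nu>\<^sub>1 \<bullet> a\<^sub>0) * (\<nu>\<^sub>2 \<bullet> a\<^sub>1) * (\<nu>\<^sub>3 \<bullet> a\<^sub>2))"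
    by simp
  have "n \<bullet> a\<^sub>3 = - (\<rho> * ((\<nu>\<^sub>1 \<bullet> a\<^sub>2) * (\<nu>\<^sub>2 \<bullet> a\<^sub>3)))"
    unfolding n by (simp add: inner_diff_left right inc algebra_simps)
  moreover have "\<nu>\<^sub>0 \<bullet> v = \<mu> * (\<nu>\<^sub>0 \<bullet> a\<^sub>1)" by (simp add: left inc)
  ultimately show "(\<nu>\<^sub>0 \<bullet> v) * (n \<bullet> a\<^sub>3) = - (\<mu> * \<rho> * ((\<nu>\<^sub>0 \<bullet> a\<^sub>1) * (\<nu>\<^sub>1 \<bullet> a\<^sub>2) * (\<nu>\<^sub>2 \<bullet> a\<^sub>3)))"
    by simp
qed

lemma merged_polygonD:
  assumes m: "4 \<le> m" and i: "i \<in> {1..m}" and P: "polygon (m - 1) (merge m i V A)"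
  shows "is_point V" "A (cyc m (i - 1)) \<noteq> V" "V \<noteq> A (cyc m (i + 2))"
proof -
  have m1: "1 \<le> m - 1" using m by simp
  have P': "is_point (merge m i V A (cyc (m - 1) j))"
    "merge m i V A (cyc (m - 1) j) \<noteq> merge m i V A (cyc (m - 1) (j + 1))" for j
    using P cyc_in_range[OF m1, of j] cyc_cyc_add[OF m1, of j 1] unfolding polygon_def by metis+
  have e: "i - 1 + 1 = i" "i - 1 + 2 = i + 1" using i by auto
  have 3: "merge m i V A (cyc (m - 1) (i + 1)) = A (cyc m (i + 2))"
    using merge_cyc(3)[OF m i, of 2] m e by simp
  show "is_point V" using P'(1)[of i] merge_cyc(2)[OF m i, of V A] by simp
  show "A (cyc m (i - 1)) \<noteq> V"
    using P'(2)[of "i - 1"] unfolding e merge_cyc(1,2)[OF m i] .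
  show "V \<noteq> A (cyc m (i + 2))" using P'(2)[of i] unfolding 3 merge_cyc(2)[OF m i] .
qed

text \<open>If \<open>\<mu> = 0\<close>, then \<open>v\<close> is a multiple of the representative
  before the pair, so the new vertex equals its predecessor, which \<open>polygon\<close> forbids.
  Likewise \<open>\<rho> = 0\<close> would make it equal to its successor.\<close>

lemma new_vertex_coords:
  assumes m: "4 \<le> m" and i: "i \<in> {1..m}"
    and C: "\<forall>j\<in>{1..m}. A j = span {a j}"
    and P: "polygon (m - 1) (merge m i (new_vertex m A i) A)"
  obtains v \<kappa> \<mu> \<rho> \<sigma> where "v \<noteq> 0" "new_vertex m A i = span {v}" "\<mu> \<noteq> 0" "\<rho> \<noteq> 0"
    "v = \<kappa> *\<^sub>R a (cyc m (i - 1)) + \<mu> *\<^sub>R a i"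
    "v = \<rho> *\<^sub>R a (cyc m (i + 1)) + \<sigma> *\<^sub>R a (cyc m (i + 2))"
proof -
  have r: "cyc m j \<in> {1..m}" for j using cyc_in_range m by simp
  let ?V = "new_vertex m A i"
  note D = merged_polygonD[OF m i P]
  obtain v where v: "v \<noteq> 0" "?V = span {v}" using is_pointE[OF D(1)] by metis
  have "?V = span {a (cyc m (i - 1)), a i} \<inter> span {a (cyc m (i + 1)), a (cyc m (i + 2))}"
    using C r i by (simp add: new_vertex_def meet_def join_span)
  then have "v \<in> span {a (cyc m (i - 1)), a i}" "v \<in> span {a (cyc m (i + 1)), a (cyc m (i + 2))}"
    using v span_base[of v "{v}"] by auto
  then obtain \<kappa> \<mu> \<rho> \<sigma> where
    eq: "v = \<kappa> *\<^sub>R a (cyc m (i - 1)) + \<mu> *\<^sub>R a i"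
    "v = \<rho> *\<^sub>R a (cyc m (i + 1)) + \<sigma> *\<^sub>R a (cyc m (i + 2))"
    by (meson in_span_pair)
  have "\<mu> \<noteq> 0"
  proof
    assume "\<mu> = 0"
    then have "v \<in> span {a (cyc m (i - 1))}" using eq(1) by (simp add: span_base span_scale)
    then show False using span_singleton_eq v D(2) C r by metis
  qed
  moreover have "\<rho> \<noteq> 0"
  proof
    assume "\<rho> = 0"
    then have "v \<in> span {a (cyc m (i + 2))}" using eq(2) by (simp add: span_base span_scale)
    then show False using span_singleton_eq v D(3) C r by metis
  qed
  ultimately show thesis using that v eq by blast
qed

lemma merge_Pair: "merge m i (x, y) (\<lambda>j. (X j, Y j)) j = (merge m i x X j, merge m i y Y j)"
  by (simp add: merge_def)

lemma step_preserves_balanced: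
  assumes m: "4 \<le> m" and i: "i \<in> {1..m}"
    and C: "homogeneous_coords m A g a \<nu>"
    and S: "step_defined m A g i"
  obtains b \<xi> where
    "homogeneous_coords (m - 1) (merge m i (new_vertex m A i) A) (merge m i (new_line m A g i) g) b \<xi>"
    "balanced (m - 1) b \<xi> \<longleftrightarrow> balanced m a \<nu>"
proof -
  have r: "cyc m j \<in> {1..m}" for j using cyc_in_range m by simp
  have C': "a j \<noteq> 0" "A j = span {a j}" "\<nu> j \<noteq> 0" "g j = {x. \<nu> j \<bullet> x = 0}" "\<nu> j \<bullet> a j = 0"
    if "j \<in> {1..m}" for j
    using C that by (auto simp: homogeneous_coords_def)
  have vertices: "\<forall>j\<in>{1..m}. A j = span {a j}" using C'(2) by blast
  have P: "polygon (m - 1) (merge m i (new_vertex m A i) A)"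
    using S by (simp add: step_defined_def)
  obtain v \<kappa> \<mu> \<rho> \<sigma> where v: "v \<noteq> 0" "new_vertex m A i = span {v}" and nz: "\<mu> \<noteq> 0" "\<rho> \<noteq> 0" and
    eq: "v = \<kappa> *\<^sub>R a (cyc m (i - 1)) + \<mu> *\<^sub>R a i"
    "v = \<rho> *\<^sub>R a (cyc m (i + 1)) + \<sigma> *\<^sub>R a (cyc m (i + 2))"
    by (rule new_vertex_coords[OF m i vertices P])
  define n where "n = (\<nu> (cyc m (i + 1)) \<bullet> v) *\<^sub>R \<nu> i - (\<nu> i \<bullet> v) *\<^sub>R \<nu> (cyc m (i + 1))"
  have ne: "{x. \<nu> i \<bullet> x = 0} \<noteq> {x. \<nu> (cyc m (i + 1)) \<bullet> x = 0}"
    and off: "span {v} \<noteq> meet {x. \<nu> i \<bullet> x = 0} {x. \<nu> (cyc m (i + 1)) \<bullet> x = 0}"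
    using S unfolding step_defined_def v(2) C'(4)[OF i] C'(4)[OF r] by blast+
  have line: "n \<noteq> 0" "new_line m A g i = {x. n \<bullet> x = 0}"
    unfolding new_line_def v(2) C'(4)[OF i] C'(4)[OF r]
    by (fact merged_line_eq[OF n_def C'(3)[OF i] C'(3)[OF r] v(1) ne off])+
  have vn: "n \<bullet> v = 0" by (simp add: n_def inner_diff_left)
  have "homogeneous_coords (m - 1) (merge m i (new_vertex m A i) A) (merge m i (new_line m A g i) g)
      (merge m i v a) (merge m i n \<nu>)"
    unfolding homogeneous_coords_def
  proof
    fix j assume "j \<in> {1..m - 1}"
    \<comment> \<open>Entry \<open>j\<close> of a merged sequence is the new entry or the old entry
      \<open>j\<close> or \<open>j + 1\<close>, so the facts for both indices are collected.\<close>
    then have "j \<in> {1..m}" "j + 1 \<in> {1..m}" by auto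
    note C'[OF this(1)] C'[OF this(2)]
    then show "merge m i v a j \<noteq> 0 \<and> merge m i (new_vertex m A i) A j = span {merge m i v a j} \<and>
        merge m i n \<nu> j \<noteq> 0 \<and> merge m i (new_line m A g i) g j = {x. merge m i n \<nu> j \<bullet> x = 0} \<and>
        merge m i n \<nu> j \<bullet> merge m i v a j = 0"
      using v line vn by (cases "i < m"; cases "j = 1") (simp_all add: merge_def)
  qed
  moreover have "balanced (m - 1) (merge m i v a) (merge m i n \<nu>) \<longleftrightarrow> balanced m a \<nu>"
  proof -
    note alg = merged_inner_products[OF eq C'(5)[OF r] C'(5)[OF i] C'(5)[OF r] C'(5)[OF r] n_def]
    \<comment> \<open>Normals and vertices are merged together as one sequence of pairs;
      \<open>F\<close> takes the normal from one pair and the vertex from its neighbour.\<close>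
    obtain T where T:
      "(\<Prod>j=1..m. \<nu> (cyc m (j + 1)) \<bullet> a j) = (\<nu> i \<bullet> a (cyc m (i - 1))) *
         (\<nu> (cyc m (i + 1)) \<bullet> a i) * (\<nu> (cyc m (i + 2)) \<bullet> a (cyc m (i + 1))) * T"
      "\<And>x y. (\<Prod>j=1..m - 1. merge m i x \<nu> (cyc (m - 1) (j + 1)) \<bullet> merge m i y a j) =
         (x \<bullet> a (cyc m (i - 1))) * (\<nu> (cyc m (i + 2)) \<bullet> y) * T"
    proof (rule cyclic_prod_merge[OF m i, of "\<lambda>p q. fst q \<bullet> snd p" "\<lambda>j. (\<nu> j, a j)"], goal_cases)
      case prem: (1 T)
      show ?case
      proof (rule that[of T], goal_cases)
        case 1
        show ?case using prem(2) by simp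
      next
        case (2 x y)
        show ?case using prem(3)[of "(x, y)"] by (simp add: merge_Pair)
      qed
    qed
    obtain U where U:
      "(\<Prod>j=1..m. \<nu> j \<bullet> a (cyc m (j + 1))) = (\<nu> (cyc m (i - 1)) \<bullet> a i) *
         (\<nu> i \<bullet> a (cyc m (i + 1))) * (\<nu> (cyc m (i + 1)) \<bullet> a (cyc m (i + 2))) * U"
      "\<And>x y. (\<Prod>j=1..m - 1. merge m i x \<nu> j \<bullet> merge m i y a (cyc (m - 1) (j + 1))) =
         (\<nu> (cyc m (i - 1)) \<bullet> y) * (x \<bullet> a (cyc m (i + 2))) * U"
    proof (rule cyclic_prod_merge[OF m i, of "\<lambda>p q. fst p \<bullet> snd q" "\<lambda>j. (\<nu> j, a j)"], goal_cases)
      case prem: (1 U)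
      show ?case
      proof (rule that[of U], goal_cases)
        case 1
        show ?case using prem(2) by simp
      next
        case (2 x y)
        show ?case using prem(3)[of "(x, y)"] by (simp add: merge_Pair)
      qed
    qed
    let ?L = "\<Prod>j=1..m. \<nu> (cyc m (j + 1)) \<bullet> a j" and ?R = "\<Prod>j=1..m. \<nu> j \<bullet> a (cyc m (j + 1))"
    have "balanced (m - 1) (merge m i v a) (merge m i n \<nu>) \<longleftrightarrow>
        \<mu> * \<rho> * ?L = (-1) ^ (m - 1) * (- (\<mu> * \<rho> * ?R))"
      unfolding balanced_def T(2) U(2) alg T(1) U(1) by (simp add: mult.assoc)
    \<comment> \<open>The minus sign from \<open>merged_inner_products\<close> compensates for the
      change of parity from \<open>m\<close> to \<open>m - 1\<close>.\<close>
    also have "(-1) ^ (m - 1) * (- (\<mu> * \<rho> * ?R)) = \<mu> * \<rho> * ((-1) ^ m * ?R)"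
      using m by (cases m) auto
    finally show ?thesis using nz by (simp add: balanced_def)
  qed
  ultimately show thesis by (rule that)
qed

section \<open>Whole reductions and the triangles they end in\<close>

lemma reduces_balanced:
  assumes "reduces n A g m B h" "homogeneous_coords n A g a \<nu>"
  obtains b \<xi> where "homogeneous_coords m B h b \<xi>" "balanced m b \<xi> \<longleftrightarrow> balanced n a \<nu>"
proof -
  have "\<exists>b \<xi>. homogeneous_coords m B h b \<xi> \<and> (balanced m b \<xi> \<longleftrightarrow> balanced n a \<nu>)"
    using assms
  proof (induction rule: reduces.induct)
    case start
    then show ?case by blast
  next
    case (step m B h i)
    then obtain b \<xi> where b: "homogeneous_coords m B h b \<xi>" "balanced m b \<xi> \<longleftrightarrow> balanced n a \<nu>"
      by blast
    show ?case
      by (rule step_preserves_balanced[OF step.hyps(2,3) b(1) step.hyps(4)]) (use b(2) in blast)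
  qed
  then show thesis using that by blast
qed

lemma reduces_le: "reduces n A g m B h \<Longrightarrow> m \<le> n"
  by (induction rule: reduces.induct) auto

lemma reduces_polygon: "reduces n A g m B h \<Longrightarrow> polygon n A \<Longrightarrow> polygon m B"
  by (induction rule: reduces.induct) (auto simp: step_defined_def)

text \<open>A line through all three final vertices contains \<open>v\<close> and both unreplaced
  vertices. As \<open>\<mu>\<close> and \<open>\<rho>\<close> are nonzero, the two expressions for
  \<open>v\<close> can be solved for the replaced vertices, so both intersected sides equal that
  line.\<close>

lemma step_to_triangle:
  assumes i: "i \<in> {1..4}" and C: "homogeneous_coords 4 A g a \<nu>" and poly: "polygon 4 A"
    and S: "step_defined 4 A g i"
  shows "is_triangle (merge 4 i (new_vertex 4 A i) A)"
  unfolding is_triangle_def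
proof
  have r: "cyc 4 j \<in> {1..4}" "cyc 3 j \<in> {1..3}" for j using cyc_in_range by simp_all
  have vertices: "\<forall>j\<in>{1..4}. A j = span {a j}" and a: "a (cyc 4 j) \<noteq> 0" for j
    using C r by (auto simp: homogeneous_coords_def)
  let ?V = "new_vertex 4 A i"
  let ?B = "merge 4 i ?V A"
  have P: "polygon (4 - 1) ?B" using S by (simp add: step_defined_def)
  show "\<forall>j\<in>{1..3}. is_point (?B j)" using P by (simp add: polygon_def)
  obtain v \<kappa> \<mu> \<rho> \<sigma> where v: "v \<noteq> 0" "?V = span {v}" and nz: "\<mu> \<noteq> 0" "\<rho> \<noteq> 0" and
    eq: "v = \<kappa> *\<^sub>R a (cyc 4 (i - 1)) + \<mu> *\<^sub>R a i"
    "v = \<rho> *\<^sub>R a (cyc 4 (i + 1)) + \<sigma> *\<^sub>R a (cyc 4 (i + 2))"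
    by (rule new_vertex_coords[OF order_refl i vertices P])
  have ci: "cyc 4 i = i" using i by (rule cyc_id)
  have side: "is_line (span {a (cyc 4 j), a (cyc 4 (j + 1))})" for j
  proof -
    have e: "cyc 4 (cyc 4 j + 1) = cyc 4 (j + 1)" by (rule cyc_cyc_add) simp
    have "A (cyc 4 j) \<noteq> A (cyc 4 (j + 1))"
      using poly r(1)[of j] unfolding polygon_def e[symmetric] by blast
    then show ?thesis using vertices r(1) a by (intro is_line_span) auto
  qed
  have sides: "is_line (span {a (cyc 4 (i - 1)), a i})"
    "is_line (span {a (cyc 4 (i + 1)), a (cyc 4 (i + 2))})"
    using side[of "i - 1"] side[of "i + 1"] i ci by simp_all
  show "\<not> (\<exists>l. is_line l \<and> (\<forall>j\<in>{1..3}. ?B j \<subseteq> l))"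
  proof
    assume "\<exists>l. is_line l \<and> (\<forall>j\<in>{1..3}. ?B j \<subseteq> l)"
    then obtain l where l: "is_line l" and sub: "\<And>j. ?B (cyc 3 j) \<subseteq> l" using r(2) by blast
    have lsub: "subspace l" using l by (simp add: is_line_def)
    have m4: "(4::nat) \<le> 4" "(2::nat) \<le> 2" "(2::nat) < 4" by simp_all
    have "i - 1 + 2 = i + 1" using i by auto
    then have "A (cyc 4 (i - 1)) \<subseteq> l" "?V \<subseteq> l" "A (cyc 4 (i + 2)) \<subseteq> l"
      using sub[of "i - 1"] sub[of i] sub[of "i - 1 + 2"]
        merge_cyc(1,2)[OF m4(1) i, of ?V A] merge_cyc(3)[OF m4(1) i m4(2,3), of ?V A] by simp_all
    then have mem: "a (cyc 4 (i - 1)) \<in> l" "v \<in> l" "a (cyc 4 (i + 2)) \<in> l"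
      using vertices r(1) v(2) span_base[of _ "{_}"] by blast+
    have "a i = (1 / \<mu>) *\<^sub>R (v - \<kappa> *\<^sub>R a (cyc 4 (i - 1)))"
      unfolding eq(1) using nz by simp
    then have 1: "a i \<in> l" using mem lsub by (metis subspace_diff subspace_scale)
    have "a (cyc 4 (i + 1)) = (1 / \<rho>) *\<^sub>R (v - \<sigma> *\<^sub>R a (cyc 4 (i + 2)))"
      unfolding eq(2) using nz by simp
    then have 2: "a (cyc 4 (i + 1)) \<in> l" using mem lsub by (metis subspace_diff subspace_scale)
    have "span {a (cyc 4 (i - 1)), a i} = l"
      using sides(1) l mem 1 lsub by (intro is_line_eq span_minimal) auto
    moreover have "span {a (cyc 4 (i + 1)), a (cyc 4 (i + 2))} = l"
      using sides(2) l mem 2 lsub by (intro is_line_eq span_minimal) auto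
    ultimately have "join (A (cyc 4 (i - 1))) (A i) = join (A (cyc 4 (i + 1))) (A (cyc 4 (i + 2)))"
      using vertices r(1) i by (simp add: join_span)
    then show False using S by (simp add: step_defined_def)
  qed
qed

text \<open>For \<open>n = 3\<close> no step is made and the given vertices may be collinear, as
  \<open>polygon\<close> only separates neighbours. But then there is just one outcome, so all
  reductions still agree on being a triangle.\<close>

lemma reduces_triangle:
  assumes R: "reduces n A g 3 B h" and C: "homogeneous_coords n A g a \<nu>" and P: "polygon n A"
  shows "(B = A \<and> h = g) \<and> n = 3 \<or> is_triangle B \<and> n \<noteq> 3"
  using R
proof (cases rule: reduces.cases)
  case start
  then show ?thesis by simp
next
  case (step m B' h' i)
  then have m: "m = 4" by simp
  note R' = step(4)[unfolded m]
  obtain b \<xi> where b: "homogeneous_coords 4 B' h' b \<xi>"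
    by (rule reduces_balanced[OF R' C])
  have "is_triangle (merge 4 i (new_vertex 4 B' i) B')"
    using step m by (intro step_to_triangle[OF _ b reduces_polygon[OF R' P]]) auto
  then show ?thesis using step m reduces_le[OF R'] by auto
qed

section \<open>Concurrency in a triangle as a vanishing determinant\<close>

text \<open>Used in two dual ways: for normals, \<open>x\<close> represents a common point of three
  lines; for vertices, \<open>x\<close> is the normal of a line through three points.\<close>

lemma det_vector_3_eq_0_iff:
  fixes u\<^sub>1 u\<^sub>2 u\<^sub>3 :: "real^3"
  shows "det (vector [u\<^sub>1, u\<^sub>2, u\<^sub>3] :: real^3^3) = 0 \<longleftrightarrow>
    (\<exists>x. x \<noteq> 0 \<and> u\<^sub>1 \<bullet> x = 0 \<and> u\<^sub>2 \<bullet> x = 0 \<and> u\<^sub>3 \<bullet> x = 0)"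
proof -
  let ?M = "vector [u\<^sub>1, u\<^sub>2, u\<^sub>3] :: real^3^3"
  have "det ?M = 0 \<longleftrightarrow> rank ?M \<noteq> CARD(3)"
    using det_eq_0_rank[of ?M] rank_bound[of ?M] by auto
  also have "\<dots> \<longleftrightarrow> (\<exists>x. x \<noteq> 0 \<and> ?M *v x = 0)"
    by (rule matrix_nonfull_linear_equations_eq[symmetric])
  also have "\<dots> \<longleftrightarrow> (\<exists>x. x \<noteq> 0 \<and> u\<^sub>1 \<bullet> x = 0 \<and> u\<^sub>2 \<bullet> x = 0 \<and> u\<^sub>3 \<bullet> x = 0)"
    by (simp add: vec_eq_iff forall_3 matrix_vector_mul_component)
  finally show ?thesis .
qed

lemma concurrent_iff_balanced:
  assumes C: "homogeneous_coords 3 B h b \<xi>" and T: "is_triangle B"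
  shows "concurrent h \<longleftrightarrow> balanced 3 b \<xi>"
proof -
  have 3: "{1..3} = {1, 2, 3::nat}" by auto
  have C': "B 1 = span {b 1}" "B 2 = span {b 2}" "B 3 = span {b 3}"
    "h 1 = {x. \<xi> 1 \<bullet> x = 0}" "h 2 = {x. \<xi> 2 \<bullet> x = 0}" "h 3 = {x. \<xi> 3 \<bullet> x = 0}"
    "\<xi> 1 \<bullet> b 1 = 0" "\<xi> 2 \<bullet> b 2 = 0" "\<xi> 3 \<bullet> b 3 = 0"
    using C by (auto simp: homogeneous_coords_def)
  let ?N = "vector [\<xi> 1, \<xi> 2, \<xi> 3] :: real^3^3" and ?B = "vector [b 1, b 2, b 3] :: real^3^3"
  have "det ?B \<noteq> 0"
  proof
    assume "det ?B = 0"
    then obtain x where x: "x \<noteq> 0" "b 1 \<bullet> x = 0" "b 2 \<bullet> x = 0" "b 3 \<bullet> x = 0"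
      by (auto simp: det_vector_3_eq_0_iff)
    then have "\<forall>i\<in>{1..3}. B i \<subseteq> {y. x \<bullet> y = 0}"
      unfolding 3 by (auto simp: C' span_singleton inner_commute simp del: One_nat_def)
    then show False using T is_line_hyperplane[OF x(1)] unfolding is_triangle_def by blast
  qed
  have "concurrent h \<longleftrightarrow> (\<exists>x. x \<noteq> 0 \<and> \<xi> 1 \<bullet> x = 0 \<and> \<xi> 2 \<bullet> x = 0 \<and> \<xi> 3 \<bullet> x = 0)"
  proof
    assume "concurrent h"
    then obtain P where P: "is_point P" "\<forall>i\<in>{1..3}. P \<subseteq> h i" by (auto simp: concurrent_def)
    obtain x where x: "x \<noteq> 0" "P = span {x}" using is_pointE[OF P(1)] .
    have "x \<in> P" using x by (simp add: span_base)
    then show "\<exists>x. x \<noteq> 0 \<and> \<xi> 1 \<bullet> x = 0 \<and> \<xi> 2 \<bullet> x = 0 \<and> \<xi> 3 \<bullet> x = 0"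
      using x(1) P(2) unfolding 3 by (auto simp: C' simp del: One_nat_def)
  next
    assume "\<exists>x. x \<noteq> 0 \<and> \<xi> 1 \<bullet> x = 0 \<and> \<xi> 2 \<bullet> x = 0 \<and> \<xi> 3 \<bullet> x = 0"
    then obtain x where x: "x \<noteq> 0" "\<xi> 1 \<bullet> x = 0" "\<xi> 2 \<bullet> x = 0" "\<xi> 3 \<bullet> x = 0" by blast
    then have "\<forall>i\<in>{1..3}. span {x} \<subseteq> h i"
      unfolding 3 by (auto simp: C' span_singleton simp del: One_nat_def)
    then show "concurrent h" using is_point_span[OF x(1)] unfolding concurrent_def by blast
  qed
  \<comment> \<open>The nonzero factor brings in the vertices: the product matrix has the entries
    \<open>\<xi> i \<bullet> b j\<close>.\<close>
  also have "\<dots> \<longleftrightarrow> det ?N * det ?B = 0"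
    using \<open>det ?B \<noteq> 0\<close> unfolding det_vector_3_eq_0_iff[symmetric] by simp
  also have "det ?N * det ?B = det (?N ** transpose ?B)"
    by (simp add: det_mul)
  \<comment> \<open>Incidence makes the diagonal zero, so only the two 3-cycles survive in the
    determinant. Their sum vanishes exactly if \<open>balanced\<close> holds, with the sign
    \<open>(-1) ^ 3\<close>.\<close>
  also have "\<dots> = (\<xi> 1 \<bullet> b 2) * (\<xi> 2 \<bullet> b 3) * (\<xi> 3 \<bullet> b 1) + (\<xi> 1 \<bullet> b 3) * (\<xi> 2 \<bullet> b 1) * (\<xi> 3 \<bullet> b 2)"
  proof -
    have "(?N ** transpose ?B) $ i $ j = ?N $ i \<bullet> ?B $ j" for i j
      by (simp add: matrix_matrix_mult_def transpose_def inner_vec_def)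
    then show ?thesis by (simp add: det_3 C' del: One_nat_def)
  qed
  also have "\<dots> = 0 \<longleftrightarrow> balanced 3 b \<xi>"
    unfolding balanced_def 3 by (simp add: cyc_def eq_neg_iff_add_eq_0 ac_simps flip: numeral_2_eq_2)
  finally show ?thesis .
qed

section \<open>The quotients at the feet in terms of normals\<close>

text \<open>The third coordinate 1 turns
  \<open>hom D = s *\<^sub>R hom P + t *\<^sub>R hom Q\<close> into an affine combination, so the
  quotient is \<open>t / s\<close>. Applying \<open>\<nu>\<close> to the combination gives 0, which
  determines \<open>t / s\<close>.\<close>

lemma oriented_ratio_foot:
  fixes P Q D :: "real^2" and \<nu> :: "real^3"
  defines "hom \<equiv> \<lambda>p::real^2. vector [p$1, p$2, 1] :: real^3"
  assumes D: "ordinary D = meet {x. \<nu> \<bullet> x = 0} (join (ordinary P) (ordinary Q))" and DQ: "D \<noteq> Q"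
  shows "\<nu> \<bullet> hom Q \<noteq> 0" and "oriented_ratio P D D Q = - (\<nu> \<bullet> hom P) / (\<nu> \<bullet> hom Q)"
proof -
  have D': "span {hom D} = {x. \<nu> \<bullet> x = 0} \<inter> span {hom P, hom Q}"
    using D by (simp add: ordinary_def hom_def meet_def join_span)
  then have "hom D \<in> {x. \<nu> \<bullet> x = 0} \<inter> span {hom P, hom Q}" by (metis singletonI span_base)
  then obtain s t where st: "hom D = s *\<^sub>R hom P + t *\<^sub>R hom Q" and inc: "\<nu> \<bullet> hom D = 0"
    by (auto elim: in_span_pair)
  have "\<forall>i. hom D $ i = s * hom P $ i + t * hom Q $ i" by (simp add: st)
  then have c: "D $ 1 = s * P $ 1 + t * Q $ 1" "D $ 2 = s * P $ 2 + t * Q $ 2" "1 = s + t"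
    by (simp_all add: hom_def forall_3)
  then have "P = s *\<^sub>R P + t *\<^sub>R P" "Q = s *\<^sub>R Q + t *\<^sub>R Q"
    by (simp_all flip: scaleR_left_distrib)
  moreover have "D = s *\<^sub>R P + t *\<^sub>R Q"
    using c by (simp add: vec_eq_iff forall_2)
  ultimately have diff: "D - P = t *\<^sub>R (Q - P)" "Q - D = s *\<^sub>R (Q - P)"
    by (simp_all add: algebra_simps)
  have s: "s \<noteq> 0" and PQ: "Q - P \<noteq> 0" using diff(2) DQ by auto
  show Q: "\<nu> \<bullet> hom Q \<noteq> 0"
  proof
    assume "\<nu> \<bullet> hom Q = 0"
    \<comment> \<open>Otherwise \<open>Q\<close> would be on both intersected lines and hence be
      their common point \<open>D\<close>.\<close>
    then have "hom Q \<in> span {hom D}" unfolding D' by (simp add: span_base)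
    then obtain k where "hom Q = k *\<^sub>R hom D" by (auto simp: span_singleton)
    then have "\<forall>i. hom Q $ i = k * hom D $ i" by simp
    then have "k = 1" "Q $ 1 = k * D $ 1" "Q $ 2 = k * D $ 2" by (simp_all add: hom_def forall_3)
    then show False using DQ by (simp add: vec_eq_iff forall_2)
  qed
  have "s * (\<nu> \<bullet> hom P) + t * (\<nu> \<bullet> hom Q) = 0" using inc by (simp add: st inner_add_right)
  then have t: "t / s = - (\<nu> \<bullet> hom P) / (\<nu> \<bullet> hom Q)" using s Q by (simp add: field_simps)
  \<comment> \<open>Both oriented lengths are multiples of this number, which must be nonzero to
    cancel.\<close>
  have "(Q - P) \<bullet> sgn (Q - D) \<noteq> 0"
    unfolding diff sgn_scaleR using s PQ by (simp add: sgn_div_norm sgn_if)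
  then have "oriented_ratio P D D Q = t / s"
    unfolding oriented_ratio_def oriented_length_def diff(1) by (simp add: diff(2))
  then show "oriented_ratio P D D Q = - (\<nu> \<bullet> hom P) / (\<nu> \<bullet> hom Q)" using t by simp
qed

lemma foot_product_eq_1_iff:
  fixes A D :: "nat \<Rightarrow> real^2"
  defines "a \<equiv> \<lambda>i. vector [A i $ 1, A i $ 2, 1] :: real^3"
  assumes n: "n \<ge> 1" and g: "\<forall>i\<in>{1..n}. g i = {x. \<nu> i \<bullet> x = 0}"
    and foot: "\<forall>i\<in>{1..n}. foot n A g i (D i)"
  shows "(\<Prod>i=1..n. oriented_ratio (A i) (D (cyc n (i + 1))) (D (cyc n (i + 1))) (A (cyc n (i + 2)))) = 1
    \<longleftrightarrow> balanced n a \<nu>"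
proof -
  have ratio: "\<nu> (cyc n (i + 1)) \<bullet> a (cyc n (i + 2)) \<noteq> 0"
    "oriented_ratio (A i) (D (cyc n (i + 1))) (D (cyc n (i + 1))) (A (cyc n (i + 2))) =
      - 1 * ((\<nu> (cyc n (i + 1)) \<bullet> a i) / (\<nu> (cyc n (i + 1)) \<bullet> a (cyc n (i + 2))))"
    if i: "i \<in> {1..n}" for i
  proof -
    let ?k = "cyc n (i + 1)"
    have k: "?k \<in> {1..n}" using cyc_in_range n by simp
    \<comment> \<open>For \<open>i = n\<close> the successor is 1, and the predecessor index 0 is
      sent back to \<open>n\<close>.\<close>
    have prev: "cyc n (?k - 1) = i"
    proof (cases "i = n")
      case True
      then show ?thesis using n cyc_add_period[of n 1] cyc_id[of 1 n] cyc_zero[of n] by simp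
    next
      case False
      then show ?thesis using i cyc_id[of "i + 1" n] cyc_id[of i n] by simp
    qed
    have succ: "cyc n (?k + 1) = cyc n (i + 2)" using cyc_cyc_add[OF n, of "i + 1" 1] by simp
    have "foot n A g ?k (D ?k)" using foot k by blast
    then have f: "ordinary (D ?k) = meet {x. \<nu> ?k \<bullet> x = 0} (join (ordinary (A i)) (ordinary (A (cyc n (i + 2)))))"
      "D ?k \<noteq> A (cyc n (i + 2))"
      using g k unfolding foot_def prev succ by auto
    show "\<nu> ?k \<bullet> a (cyc n (i + 2)) \<noteq> 0"
      "oriented_ratio (A i) (D ?k) (D ?k) (A (cyc n (i + 2))) =
        - 1 * ((\<nu> ?k \<bullet> a i) / (\<nu> ?k \<bullet> a (cyc n (i + 2))))"
      using oriented_ratio_foot[OF f] by (simp_all add: a_def)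
  qed
  let ?L = "\<Prod>i=1..n. \<nu> (cyc n (i + 1)) \<bullet> a i" and ?R = "\<Prod>i=1..n. \<nu> i \<bullet> a (cyc n (i + 1))"
  let ?S = "\<Prod>i=1..n. \<nu> (cyc n (i + 1)) \<bullet> a (cyc n (i + 2))"
  \<comment> \<open>The denominators are the factors of \<open>?R\<close> with all indices moved by
    one, so the cyclic product is the same.\<close>
  have "?S = (\<Prod>k<n. \<nu> (cyc n (2 + k)) \<bullet> a (cyc n (cyc n (2 + k) + 1)))"
    unfolding cyc_cyc_add[OF n] by (simp add: prod.atLeast1_atMost_eq)
  also have "\<dots> = ?R"
    by (rule prod_cyc_shift[OF n, of "\<lambda>i. \<nu> i \<bullet> a (cyc n (i + 1))" 2])
  finally have SR: "?S = ?R" .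
  have "?S \<noteq> 0" using ratio(1) by (simp add: prod_zero_iff)
  have "(\<Prod>i=1..n. oriented_ratio (A i) (D (cyc n (i + 1))) (D (cyc n (i + 1))) (A (cyc n (i + 2)))) =
      (\<Prod>i=1..n. - 1 * ((\<nu> (cyc n (i + 1)) \<bullet> a i) / (\<nu> (cyc n (i + 1)) \<bullet> a (cyc n (i + 2)))))"
    by (intro prod.cong refl ratio(2))
  also have "\<dots> = (-1) ^ n * (?L / ?S)"
    unfolding prod.distrib prod_dividef by simp
  also have "\<dots> = 1 \<longleftrightarrow> balanced n a \<nu>"
    using \<open>?S \<noteq> 0\<close> unfolding SR balanced_def by (cases "even n") (auto simp: field_simps)
  finally show ?thesis .
qed

section \<open>Independence of the chosen steps and the product criterion\<close>

theorem theorem14: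
  fixes n :: nat and A D :: "nat \<Rightarrow> real^2" and g :: "nat \<Rightarrow> (real^3) set"
  assumes "n \<ge> 3"
    and "polygon n (\<lambda>i. ordinary (A i))"
    and "\<forall>i\<in>{1..n}. is_line (g i) \<and> ordinary (A i) \<subseteq> g i"
  shows
    "((\<exists>B h. reduces n (\<lambda>i. ordinary (A i)) g 3 B h \<and> is_triangle B \<and> concurrent h) \<longrightarrow>
      (\<forall>B h. reduces n (\<lambda>i. ordinary (A i)) g 3 B h \<longrightarrow> is_triangle B \<and> concurrent h)) \<and>
     ((\<exists>B h. reduces n (\<lambda>i. ordinary (A i)) g 3 B h \<and> is_triangle B) \<and>
      (\<forall>i\<in>{1..n}. foot n A g i (D i)) \<longrightarrow>
      ((\<exists>B h. reduces n (\<lambda>i. ordinary (A i)) g 3 B h \<and> is_triangle B \<and> concurrent h) \<longleftrightarrow>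
       (\<Prod>i=1..n. oriented_ratio (A i) (D (cyc n (i + 1))) (D (cyc n (i + 1))) (A (cyc n (i + 2)))) = 1))"
proof -
  let ?A = "\<lambda>i. ordinary (A i)"
  let ?a = "\<lambda>i. vector [A i $ 1, A i $ 2, 1] :: real^3"
  have "\<forall>i\<in>{1..n}. \<exists>\<nu>. \<nu> \<noteq> 0 \<and> g i = {x. \<nu> \<bullet> x = 0}"
    using assms(3) by (metis is_lineE)
  then obtain \<nu> where \<nu>: "\<forall>i\<in>{1..n}. \<nu> i \<noteq> 0 \<and> g i = {x. \<nu> i \<bullet> x = 0}"
    by metis
  have C: "homogeneous_coords n ?A g ?a \<nu>"
    unfolding homogeneous_coords_def
  proof
    fix j assume j: "j \<in> {1..n}"
    have "span {?a j} \<subseteq> g j" using assms(3) j unfolding ordinary_def by blast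
    then have "?a j \<in> g j" by (simp add: span_base subset_iff)
    moreover have "?a j \<noteq> 0" by (simp add: vec_eq_iff forall_3)
    ultimately show "?a j \<noteq> 0 \<and> ?A j = span {?a j} \<and> \<nu> j \<noteq> 0 \<and> g j = {x. \<nu> j \<bullet> x = 0} \<and> \<nu> j \<bullet> ?a j = 0"
      using \<nu> j by (auto simp: ordinary_def)
  qed
  \<comment> \<open>The right-hand side mentions only the original polygon, so all reductions to
    triangles agree on concurrency.\<close>
  have invariant: "concurrent h \<longleftrightarrow> balanced n ?a \<nu>" if R: "reduces n ?A g 3 B h" and T: "is_triangle B" for B h
  proof -
    obtain b \<xi> where "homogeneous_coords 3 B h b \<xi>" "balanced 3 b \<xi> \<longleftrightarrow> balanced n ?a \<nu>"
      by (rule reduces_balanced[OF R C])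
    then show ?thesis using concurrent_iff_balanced[OF _ T] by blast
  qed
  \<comment> \<open>Either \<open>n = 3\<close> and both results are the original 3-gon, or both
    reductions end with a step and yield triangles.\<close>
  have triangle: "is_triangle B'" if "reduces n ?A g 3 B h" "is_triangle B" "reduces n ?A g 3 B' h'" for B h B' h'
    using reduces_triangle[OF that(1) C assms(2)] reduces_triangle[OF that(3) C assms(2)] that(2) by auto
  have product: "(\<Prod>i=1..n. oriented_ratio (A i) (D (cyc n (i + 1))) (D (cyc n (i + 1))) (A (cyc n (i + 2)))) = 1
      \<longleftrightarrow> balanced n ?a \<nu>" if "\<forall>i\<in>{1..n}. foot n A g i (D i)"
    using foot_product_eq_1_iff[OF _ _ that] \<nu> assms(1) by auto
  show ?thesis
  proof (intro conjI impI allI)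
    fix B' h'
    assume "\<exists>B h. reduces n ?A g 3 B h \<and> is_triangle B \<and> concurrent h"
    then obtain B h where 1: "reduces n ?A g 3 B h" "is_triangle B" "concurrent h" by blast
    assume 2: "reduces n ?A g 3 B' h'"
    show tri: "is_triangle B'" by (rule triangle[OF 1(1,2) 2])
    show "concurrent h'" using invariant[OF 1(1,2)] invariant[OF 2 tri] 1(3) by simp
  next
    assume *: "(\<exists>B h. reduces n ?A g 3 B h \<and> is_triangle B) \<and> (\<forall>i\<in>{1..n}. foot n A g i (D i))"
    then obtain B h where 1: "reduces n ?A g 3 B h" "is_triangle B" by blast
    have "(\<exists>B h. reduces n ?A g 3 B h \<and> is_triangle B \<and> concurrent h) \<longleftrightarrow> balanced n ?a \<nu>"
      using 1 invariant by blast
    then show "(\<exists>B h. reduces n ?A g 3 B h \<and> is_triangle B \<and> concurrent h) \<longleftrightarrow>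
       (\<Prod>i=1..n. oriented_ratio (A i) (D (cyc n (i + 1))) (D (cyc n (i + 1))) (A (cyc n (i + 2)))) = 1"
      using product * by simp
  qed
qed

end
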